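(* Let $M,N\ge 1$, let $T$ be a rooted directed tree on the node set $[M]$, let $\mathcal{H}=(\mathbb{C}^2)^{\otimes M\times N}$ be the Hilbert space of $M\cdot N$ qubits, let $\mathcal{H}^+\subset\mathcal{H}$ be the span of the feasible computational basis states, and let $U_{\mathrm{prep}}\colon\mathcal{H}\to\mathcal{H}$ be the unitary implemented by the state preparation algorithm for $(T,N)$ described in the context. For $\phi\in\mathbb{R}$ let $$U_{\mathrm{tag}}(\phi)=\sum_{x\in\{0,1\}^{M\times N}}\exp\!\left(i\,\frac{\omega(x)\,\phi}{M}\right)|x\rangle\langle x|,$$ where $\omega(x)$ is the number of indices $r\in[M]$ such that the $r$-th register $(x_{r,0},\dots,x_{r,N-1})$ of $x$ is identically $0$. Then for every $\phi\in\mathbb{R}$ the mixer $U_{\mathrm{prep}}\,U_{\mathrm{tag}}(\phi)\,U_{\mathrm{prep}}^\dagger$ preserves the space of feasible states, i.e. $U_{\mathrm{prep}}\,U_{\mathrm{tag}}(\phi)\,U_{\mathrm{prep}}^\dagger|\psi\rangle\in\mathcal{H}^+$ for all $|\psi\rangle\in\mathcal{H}^+$.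
   Context: **Tree.** $T$ is a rooted directed tree with node set $[M]=\{1,\dots,M\}$ whose edges point from the leaves towards the root. $E$ is the set of directed edges $(r,s)$; $(r,s)\in E$ means $r$ is an (immediate) predecessor of $s$. $\mathrm{pred}(x)$ is the set of immediate predecessors (children) of the node $x$, listed in sorted order as $P[0],\dots,P[m-1]$ with $m=|\mathrm{pred}(x)|$. Let $\psi_T=\bigcup_x\{(r,s): r,s\in\mathrm{pred}(x),\ r<s\}$. **Registers and feasibility.** The $M\cdot N$ qubits are grouped into $M$ registers $q[1],\dots,q[M]$, one per node, each consisting of $N$ qubits indexed $0,\dots,N-1$. A computational basis state is a bit array $x=(x_{r,i})_{r\in[M],\,0\le i\le N-1}$, where $x_{r,i}$ is the value of qubit $i$ of register $q[r]$. It is *feasible* if (C1) $\sum_{r\in[M]}\big(\sum_i x_{r,i}-1\big)^2=0$ (each register contains exactly one 1); (C2) $\sum_{(r,s)\in E}\sum_i x_{r,i}x_{s,i}=0$; (C3) $\sum_{(r,s)\in\psi_T}\sum_i x_{r,i}x_{s,i}=0$; and infeasible otherwise. $\mathcal{H}^+$ is the span of the feasible computational basis states. **State preparation algorithm.** All "for" loops run over inclusive ranges in the indicated order, and a loop over an empty range does nothing. *Partial W-state* $W(q,n)$, on an $N$-qubit register $q$, with integer $n\le N$: apply the Pauli $X$ gate to qubit $q[0]$; then for $i=1,\dots,n-1$ apply an $\mathrm{XX{+}YY}$ gate with angle $\phi_i$ to the qubits $q[i],q[0]$. An $\mathrm{XX{+}YY}$ gate ("continuous swap") is a two-qubit unitary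 that fixes $|00\rangle$ and $|11\rangle$ and acts on $\mathrm{span}\{|01\rangle,|10\rangle\}$ by a $2\times 2$ unitary determined by the angle. The angles $\phi_i$ (depending on $n$) are fixed so that, for $n\ge1$, $W(q,n)$ applied to $|0\cdots 0\rangle$ yields $|W_n\rangle\otimes|0\rangle^{\otimes(N-n)}$, where $|W_n\rangle=\frac{1}{\sqrt n}(|10\cdots0\rangle+|010\cdots0\rangle+\dots+|0\cdots01\rangle)$. *Make distinct* $D(q_1,q_2,n)$, on two $N$-qubit registers: for $i=0,\dots,n-1$, apply the SWAP of qubits $q_2[n]$ and $q_2[i]$ controlled on qubit $q_1[i]$ (being 1). *Add predecessors* $A(x)$, for a node $x$ with sorted predecessor list $P[0],\dots,P[m-1]$: 1. for $i=0,\dots,m-1$: apply $W(q[P[i]],\,N-1-i)$; 2. for $i=m-2,m-3,\dots,0$: for $j=i+1,\dots,m-1$: apply $D(q[P[i]],\,q[P[j]],\,N-2-i)$; 3. for $i=0,\dots,m-1$: apply $D(q[x],\,q[P[i]],\,N-1)$; 4. for $i=0,\dots,m-1$: apply $A(P[i])$ recursively. *Full algorithm*: apply $W(q[\mathrm{root}],N)$, then $A(\mathrm{root})$. $U_{\mathrm{prep}}$ is the resulting unitary on $\mathcal{H}$ (applied to arbitrary input states, not only $|0\rangle$). *)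

theory Defs
  imports "HOL-Analysis.Analysis" "HOL-Library.Function_Algebras"
begin

text \<open>
  Vectors of $\bigotimes_{q \in Q} \mathbb{C}^2$ are functions on bit arrays
  \<open>'q \<Rightarrow> bool\<close> that vanish outside the computational basis
  \<open>basis Q = Q \<rightarrow>\<^sub>E UNIV\<close>, for a finite set \<open>Q\<close> of qubit labels.
  The vector space operations are the pointwise ones.
\<close>

type_synonym 'q bits = "'q \<Rightarrow> bool"
type_synonym 'q state = "'q bits \<Rightarrow> complex"

definition basis :: "'q set \<Rightarrow> 'q bits set" where
  "basis Q = Q \<rightarrow>\<^sub>E UNIV"

definition ket :: "'q bits \<Rightarrow> 'q state" where
  "ket x = (\<lambda>y. if y = x then 1 else 0)"

definition scale :: "complex \<Rightarrow> 'q state \<Rightarrow> 'q state" where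
  "scale c \<psi> = (\<lambda>y. c * \<psi> y)"

interpretation qstate: vector_space scale
  by unfold_locales (auto simp: scale_def fun_eq_iff algebra_simps)

definition braket :: "'q set \<Rightarrow> 'q state \<Rightarrow> 'q state \<Rightarrow> complex" where
  "braket Q \<psi> \<eta> = (\<Sum>x\<in>basis Q. cnj (\<psi> x) * \<eta> x)"

text \<open>The adjoint has the matrix elements $\langle x|U^\dagger|\eta\rangle = \langle U x|\eta\rangle$.\<close>

definition adj :: "'q set \<Rightarrow> ('q state \<Rightarrow> 'q state) \<Rightarrow> 'q state \<Rightarrow> 'q state" where
  "adj Q U \<eta> = (\<lambda>x. if x \<in> basis Q then braket Q (U (ket x)) \<eta> else 0)"

lemma finite_basis: "finite Q \<Longrightarrow> finite (basis (Q :: 'q set))"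
  by (simp add: basis_def finite_PiE)

lemma braket_adj:
  assumes Q: "finite Q"
    and add: "\<And>\<psi> \<eta>. U (\<psi> + \<eta>) = U \<psi> + U \<eta>"
    and scale: "\<And>c \<psi>. U (scale c \<psi>) = scale c (U \<psi>)"
    and \<psi>: "\<And>x. x \<notin> basis Q \<Longrightarrow> \<psi> x = 0"
  shows "braket Q (U \<psi>) \<eta> = braket Q \<psi> (adj Q U \<eta>)"
proof -
  note fin = finite_basis[OF Q]
  have sum_fun: "sum f A y = (\<Sum>a\<in>A. f a y)" for f :: "'a bits \<Rightarrow> 'a state" and A y
    by (induction A rule: infinite_finite_induct) auto
  have zero: "U 0 = 0"
    using add[of 0 0] by simp
  have U_sum: "U (\<Sum>x\<in>A. f x) = (\<Sum>x\<in>A. U (f x))" for f :: "'a bits \<Rightarrow> 'a state" and A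
    by (induction A rule: infinite_finite_induct) (simp_all only: sum.infinite sum.empty sum.insert zero add not_False_eq_True)
  have "\<psi> = (\<Sum>x\<in>basis Q. scale (\<psi> x) (ket x))"
    using fin \<psi> by (intro ext) (simp add: sum_fun scale_def ket_def if_distrib sum.delta cong: if_cong)
  then have "U \<psi> = (\<Sum>x\<in>basis Q. scale (\<psi> x) (U (ket x)))"
    by (metis (no_types, lifting) U_sum scale sum.cong)
  then have "braket Q (U \<psi>) \<eta> = (\<Sum>y\<in>basis Q. \<Sum>x\<in>basis Q. cnj (\<psi> x) * (cnj (U (ket x) y) * \<eta> y))"
    by (simp add: braket_def sum_fun scale_def sum_distrib_right mult.assoc)
  also have "\<dots> = braket Q \<psi> (adj Q U \<eta>)"
    by (subst sum.swap) (simp add: braket_def adj_def sum_distrib_left)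
  finally show ?thesis .
qed

definition unitary :: "complex^2^2 \<Rightarrow> bool" where
  "unitary u \<longleftrightarrow> (let u' = (\<chi> i j. cnj (u $ j $ i)) in u' ** u = mat 1 \<and> u ** u' = mat 1)"


text \<open>
  \<open>XXYY \<theta> a b\<close> acts on the ordered pair of qubits \<open>a, b\<close>; \<open>CSWAP c a b\<close> swaps
  \<open>a\<close> and \<open>b\<close> if \<open>c\<close> is 1.
\<close>

datatype 'q gate = X 'q | XXYY real 'q 'q | CSWAP 'q 'q 'q

fun cswap_bits :: "'q \<Rightarrow> 'q \<Rightarrow> 'q \<Rightarrow> 'q bits \<Rightarrow> 'q bits" where
  "cswap_bits c a b x = (if x c then x(a := x b, b := x a) else x)"

text \<open>
  \<open>G \<theta>\<close> is the \<open>2 \<times> 2\<close> matrix, in the ordered basis $|01\rangle, |10\rangle$, by which the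
  XX+YY gate of angle \<open>\<theta>\<close> acts on $\mathrm{span}\{|01\rangle, |10\rangle\}$.
  A gate $|x\rangle \mapsto |\sigma(x)\rangle$ with a permutation \<open>\<sigma>\<close> maps \<open>\<psi>\<close> to
  \<open>\<psi> \<circ> \<sigma>\<inverse>\<close>; bit flips and controlled swaps on distinct qubits are involutions.
\<close>

fun gate_op :: "(real \<Rightarrow> complex^2^2) \<Rightarrow> 'q gate \<Rightarrow> 'q state \<Rightarrow> 'q state" where
  "gate_op G (X a) \<psi> = (\<lambda>x. \<psi> (x(a := \<not> x a)))"
| "gate_op G (XXYY \<theta> a b) \<psi> = (\<lambda>x.
     let x01 = x(a := False, b := True); x10 = x(a := True, b := False) in
     if x a = x b then \<psi> x
     else if x b then G \<theta> $ 1 $ 1 * \<psi> x01 + G \<theta> $ 1 $ 2 * \<psi> x10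
     else G \<theta> $ 2 $ 1 * \<psi> x01 + G \<theta> $ 2 $ 2 * \<psi> x10)"
| "gate_op G (CSWAP c a b) \<psi> = (\<lambda>x. \<psi> (cswap_bits c a b x))"

text \<open>Circuits are lists of gates, the first gate being applied first.\<close>

definition run :: "(real \<Rightarrow> complex^2^2) \<Rightarrow> 'q gate list \<Rightarrow> 'q state \<Rightarrow> 'q state" where
  "run G c = fold (gate_op G) c"


text \<open>
  A register is a function \<open>q :: nat \<Rightarrow> 'q\<close> from indices to qubit labels; \<open>ang n i\<close> is the angle
  $\phi_i$ used in $W(q,n)$.  Wherever the integer parameter \<open>n\<close> would be negative, truncated
  subtraction makes it 0, with the same effect: the loops below are empty in both cases.
\<close>

definition W_circ :: "(nat \<Rightarrow> nat \<Rightarrow> real) \<Rightarrow> (nat \<Rightarrow> 'q) \<Rightarrow> nat \<Rightarrow> 'q gate list" where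
  "W_circ ang q n = X (q 0) # [XXYY (ang n i) (q i) (q 0). i \<leftarrow> [1..<n]]"

definition D_circ :: "(nat \<Rightarrow> 'q) \<Rightarrow> (nat \<Rightarrow> 'q) \<Rightarrow> nat \<Rightarrow> 'q gate list" where
  "D_circ q1 q2 n = [CSWAP (q1 i) (q2 n) (q2 i). i \<leftarrow> [0..<n]]"

text \<open>$|0 \cdots 0\rangle$ and $|W_n\rangle \otimes |0\rangle^{\otimes(N-n)}$ on a single register with qubits $0, \dots, N-1$.\<close>

definition ket_zero :: "nat \<Rightarrow> nat state" where
  "ket_zero N = ket (\<lambda>i\<in>{..<N}. False)"

definition W_state :: "nat \<Rightarrow> nat \<Rightarrow> nat state" where
  "W_state N n = scale (1 / sqrt (real n)) (\<Sum>k<n. ket (\<lambda>i\<in>{..<N}. i = k))"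

definition W_angles :: "(real \<Rightarrow> complex^2^2) \<Rightarrow> (nat \<Rightarrow> nat \<Rightarrow> real) \<Rightarrow> nat \<Rightarrow> bool" where
  "W_angles G ang N \<longleftrightarrow>
     (\<forall>n. 1 \<le> n \<and> n \<le> N \<longrightarrow> run G (W_circ ang (\<lambda>i. i) n) (ket_zero N) = W_state N n)"

definition rooted_tree :: "nat \<Rightarrow> (nat \<times> nat) set \<Rightarrow> nat \<Rightarrow> bool" where
  "rooted_tree M E rt \<longleftrightarrow>
     E \<subseteq> {1..M} \<times> {1..M} \<and> rt \<in> {1..M} \<and>
     (\<forall>s. (rt, s) \<notin> E) \<and>
     (\<forall>r\<in>{1..M} - {rt}. \<exists>!s. (r, s) \<in> E) \<and>
     (\<forall>r\<in>{1..M}. (r, rt) \<in> E\<^sup>*)"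

definition pred :: "(nat \<times> nat) set \<Rightarrow> nat \<Rightarrow> nat set" where
  "pred E x = {r. (r, x) \<in> E}"

text \<open>
  Qubit \<open>i\<close> of register \<open>q[r]\<close> has the label \<open>(r, i)\<close>, so that \<open>q[r]\<close> is \<open>Pair r\<close>.
  The guard in \<open>A_circ\<close> holds for every tree and only ensures termination.
\<close>

function A_circ :: "(nat \<Rightarrow> nat \<Rightarrow> real) \<Rightarrow> (nat \<times> nat) set \<Rightarrow> nat \<Rightarrow> nat \<Rightarrow> (nat \<times> nat) gate list" where
  "A_circ ang E N x = (if finite E \<and> acyclic E then
     let P = sorted_list_of_set (pred E x); m = length P in
       concat [W_circ ang (Pair (P ! i)) (N - 1 - i). i \<leftarrow> [0..<m]] @
       concat [D_circ (Pair (P ! i)) (Pair (P ! j)) (N - 2 - i). i \<leftarrow> rev [0..<m - 1], j \<leftarrow> [i + 1..<m]] @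
       concat [D_circ (Pair x) (Pair (P ! i)) (N - 1). i \<leftarrow> [0..<m]] @
       concat (map (A_circ ang E N) P)
     else [])"
  by auto
termination
proof (relation "Wellfounded.measure (\<lambda>(ang, E, N, x). card {y. (y, x) \<in> E\<^sup>+})", goal_cases)
  case 1
  show ?case by simp
next
  case (2 ang E N x P m y)
  then have fin: "finite E" and ac: "acyclic E" by auto
  have "pred E x \<subseteq> fst ` E"
    by (force simp: pred_def)
  then have "finite (pred E x)"
    using fin finite_surj by blast
  then have yx: "(y, x) \<in> E"
    using 2 by (simp add: pred_def)
  have "{z. (z, x) \<in> E\<^sup>+} \<subseteq> fst ` (E\<^sup>+)"
    by force
  then have "finite {z. (z, x) \<in> E\<^sup>+}"
    by (rule finite_subset) (simp add: fin)
  moreover have "{z. (z, y) \<in> E\<^sup>+} \<subset> {z. (z, x) \<in> E\<^sup>+}"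
    using yx ac by (auto simp: acyclic_def intro: trancl_into_trancl)
  ultimately show ?case
    by (simp add: psubset_card_mono)
qed

declare A_circ.simps [simp del]

lemma rooted_tree_acyclic:
  assumes "rooted_tree M E rt"
  shows "finite E \<and> acyclic E"
proof
  show "finite E"
    using assms by (auto simp: rooted_tree_def intro: finite_subset)
  have sv: "t = s" if "(r, s) \<in> E" "(r, t) \<in> E" for r s t :: nat
    using that assms unfolding rooted_tree_def by blast
  have ret: "(s, r) \<in> E\<^sup>*" if "(r, s) \<in> E\<^sup>*" "(r, r) \<in> E\<^sup>+" for r s
    using that(1)
  proof (induction rule: rtrancl_induct)
    case (step y z)
    then have "(y, r) \<in> E\<^sup>+"
      using that(2) by (metis rtranclD)
    then obtain w where "(y, w) \<in> E" "(w, r) \<in> E\<^sup>*"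
      by (meson tranclD)
    then show ?case using sv step by blast
  qed simp
  show "acyclic E"
    unfolding acyclic_def
  proof (intro allI notI)
    fix r assume rr: "(r, r) \<in> E\<^sup>+"
    then have "r \<in> {1..M}"
      using assms unfolding rooted_tree_def by (metis SigmaD1 subsetD tranclD)
    then have "(r, rt) \<in> E\<^sup>*"
      using assms by (auto simp: rooted_tree_def)
    from ret[OF this rr] have "(rt, r) \<in> E\<^sup>*" .
    then have "(rt, r) \<in> E\<^sup>+"
      using rr by (metis rtranclD)
    then show False
      using assms unfolding rooted_tree_def by (meson tranclD)
  qed
qed

definition prep_circ :: "(nat \<Rightarrow> nat \<Rightarrow> real) \<Rightarrow> (nat \<times> nat) set \<Rightarrow> nat \<Rightarrow> nat \<Rightarrow> (nat \<times> nat) gate list" where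
  "prep_circ ang E rt N = W_circ ang (Pair rt) N @ A_circ ang E N rt"

definition U_prep ::
  "(real \<Rightarrow> complex^2^2) \<Rightarrow> (nat \<Rightarrow> nat \<Rightarrow> real) \<Rightarrow> (nat \<times> nat) set \<Rightarrow> nat \<Rightarrow> nat
    \<Rightarrow> (nat \<times> nat) state \<Rightarrow> (nat \<times> nat) state" where
  "U_prep G ang E rt N = run G (prep_circ ang E rt N)"


definition qubits :: "nat \<Rightarrow> nat \<Rightarrow> (nat \<times> nat) set" where
  "qubits M N = {1..M} \<times> {..<N}"

definition psi_T :: "nat \<Rightarrow> (nat \<times> nat) set \<Rightarrow> (nat \<times> nat) set" where
  "psi_T M E = (\<Union>x\<in>{1..M}. {(r, s). r \<in> pred E x \<and> s \<in> pred E x \<and> r < s})"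

definition feasible :: "nat \<Rightarrow> nat \<Rightarrow> (nat \<times> nat) set \<Rightarrow> (nat \<times> nat) bits \<Rightarrow> bool" where
  "feasible M N E x \<longleftrightarrow>
     (\<Sum>r\<in>{1..M}. ((\<Sum>i<N. of_bool (x (r, i))) - 1)\<^sup>2) = (0 :: int) \<and>
     (\<Sum>(r, s)\<in>E. \<Sum>i<N. of_bool (x (r, i)) * of_bool (x (s, i))) = (0 :: int) \<and>
     (\<Sum>(r, s)\<in>psi_T M E. \<Sum>i<N. of_bool (x (r, i)) * of_bool (x (s, i))) = (0 :: int)"

definition feasible_space :: "nat \<Rightarrow> nat \<Rightarrow> (nat \<times> nat) set \<Rightarrow> (nat \<times> nat) state set" where
  "feasible_space M N E = qstate.span (ket ` {x \<in> basis (qubits M N). feasible M N E x})"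

definition \<omega> :: "nat \<Rightarrow> nat \<Rightarrow> (nat \<times> nat) bits \<Rightarrow> nat" where
  "\<omega> M N x = card {r \<in> {1..M}. \<forall>i<N. \<not> x (r, i)}"

definition U_tag :: "nat \<Rightarrow> nat \<Rightarrow> real \<Rightarrow> (nat \<times> nat) state \<Rightarrow> (nat \<times> nat) state" where
  "U_tag M N \<phi> \<psi> =
     (\<Sum>x\<in>basis (qubits M N).
        scale (exp (\<i> * of_real (of_nat (\<omega> M N x) * \<phi> / of_nat M)) * braket (qubits M N) (ket x) \<psi>) (ket x))"

end

theory Submission
  imports Defs "HOL-Combinatorics.Transposition"
begin

text \<open>
  Write \<open>k r\<close> for the position of the 1 in register \<open>r\<close>, and give the child \<open>r\<close> with index \<open>i\<close>
  among its siblings the bound $n_r = N - 1 - i$ (and the root the bound \<open>N\<close>).  Up to its initial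
  bit flip, each partial W-state gate preserves the span of the positions below $n_r$, whatever its
  angles are.  The make-distinct circuits permute basis states, and they map the configurations
  with all \<open>k r < \<close>$n_r$ bijectively onto the feasible ones.  Hence the preparation unitary maps the
  span of a set of basis states (the image of these configurations under the bit flips) onto the
  feasible space.  As the tagging operator is diagonal, it preserves that span.
\<close>

section \<open>States supported on a set of basis states\<close>

text \<open>For finite \<open>A\<close> this is the span of the kets of \<open>A\<close>. The
  pointwise form lets zeros be tracked directly through gates, which are themselves defined by their
  amplitudes.\<close>

definition supp :: "'q bits set \<Rightarrow> 'q state set" where
  "supp A = {\<psi>. \<forall>x. x \<notin> A \<longrightarrow> \<psi> x = 0}"

lemma supp_mono: "A \<subseteq> B \<Longrightarrow> supp A \<subseteq> supp B"
  by (auto simp: supp_def)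

lemma sum_state_apply:
  fixes f :: "'i \<Rightarrow> 'q state"
  shows "sum f A y = (\<Sum>a\<in>A. f a y)"
  by (induction A rule: infinite_finite_induct) auto

lemma span_ket_eq_supp:
  assumes "finite A"
  shows "qstate.span (ket ` A) = supp A"
proof
  have "qstate.subspace (supp A)"
    by (auto simp: qstate.subspace_def supp_def scale_def)
  then show "qstate.span (ket ` A) \<subseteq> supp A"
    by (intro qstate.span_minimal) (auto simp: supp_def ket_def)
  show "supp A \<subseteq> qstate.span (ket ` A)"
  proof
    fix \<psi> :: "'a state" assume "\<psi> \<in> supp A"
    then have "\<psi> = (\<Sum>x\<in>A. scale (\<psi> x) (ket x))"
      using assms by (intro ext)
        (simp add: sum_state_apply supp_def scale_def ket_def if_distrib sum.delta cong: if_cong)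
    also have "\<dots> \<in> qstate.span (ket ` A)"
      by (intro qstate.span_sum qstate.span_scale qstate.span_base) auto
    finally show "\<psi> \<in> qstate.span (ket ` A)" .
  qed
qed

lemma braket_ket:
  assumes "finite Q" "x \<in> basis Q"
  shows "braket Q (ket x) \<psi> = \<psi> x"
proof -
  have "braket Q (ket x) \<psi> = (\<Sum>y\<in>basis Q. if y = x then \<psi> y else 0)"
    unfolding braket_def ket_def by (intro sum.cong) auto
  then show ?thesis
    using assms finite_basis[of Q] by (simp add: sum.delta)
qed

text \<open>Each amplitude at a basis state is multiplied by a phase, and those outside
  \<open>basis\<close> are set to 0, so a zero amplitude stays zero.\<close>

lemma U_tag_supp:
  assumes "\<psi> \<in> supp A"
  shows "U_tag M N \<phi> \<psi> \<in> supp A"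
proof -
  have "finite (qubits M N)"
    by (simp add: qubits_def)
  then have "U_tag M N \<phi> \<psi> = (\<Sum>x\<in>basis (qubits M N).
      scale (exp (\<i> * of_real (of_nat (\<omega> M N x) * \<phi> / of_nat M)) * \<psi> x) (ket x))"
    unfolding U_tag_def by (intro sum.cong) (simp_all add: braket_ket)
  then show ?thesis
    using assms by (auto simp: supp_def sum_state_apply scale_def ket_def intro!: sum.neutral)
qed

section \<open>Circuits\<close>

text \<open>Conditions under which a gate acts isometrically on \<open>basis Q\<close>: the qubits
  it changes lie in \<open>Q\<close>, and a control, being only read, differs from its targets,
  which makes the controlled swap an involution.\<close>

fun gate_on :: "'q set \<Rightarrow> 'q gate \<Rightarrow> bool" where
  "gate_on Q (X a) \<longleftrightarrow> a \<in> Q"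
| "gate_on Q (XXYY \<theta> a b) \<longleftrightarrow> a \<in> Q \<and> b \<in> Q \<and> a \<noteq> b"
| "gate_on Q (CSWAP c a b) \<longleftrightarrow> a \<in> Q \<and> b \<in> Q \<and> c \<noteq> a \<and> c \<noteq> b"

section \<open>Gates and circuits as isometries\<close>

lemma braket_reindex:
  assumes "\<And>x. \<sigma> (\<sigma> x) = x" "\<And>x. x \<in> basis Q \<Longrightarrow> \<sigma> x \<in> basis Q"
  shows "braket Q (\<lambda>x. \<psi> (\<sigma> x)) (\<lambda>x. \<eta> (\<sigma> x)) = braket Q \<psi> \<eta>"
  unfolding braket_def
  by (rule sum.reindex_bij_witness[of _ \<sigma> \<sigma>]) (use assms in auto)

lemma basis_upd: "x \<in> basis Q \<Longrightarrow> a \<in> Q \<Longrightarrow> x(a := v) \<in> basis Q"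
  by (auto simp: basis_def PiE_def extensional_def)

lemma unitary_entries:
  assumes "unitary u"
  shows "cnj (u$1$1) * u$1$1 + cnj (u$2$1) * u$2$1 = 1"
    "cnj (u$1$2) * u$1$2 + cnj (u$2$2) * u$2$2 = 1"
    "cnj (u$1$1) * u$1$2 + cnj (u$2$1) * u$2$2 = 0"
    "cnj (u$1$2) * u$1$1 + cnj (u$2$2) * u$2$1 = 0"
    "u$1$1 * cnj (u$1$1) + u$1$2 * cnj (u$1$2) = 1"
    "u$2$1 * cnj (u$2$1) + u$2$2 * cnj (u$2$2) = 1"
    "u$1$1 * cnj (u$2$1) + u$1$2 * cnj (u$2$2) = 0"
    "u$2$1 * cnj (u$1$1) + u$2$2 * cnj (u$1$2) = 0"
  using assms
  by (simp_all add: unitary_def Let_def vec_eq_iff matrix_matrix_mult_def forall_2 sum_2 mat_def)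

lemma unitary_2d_isometry:
  assumes "unitary u"
  shows "cnj (u$1$1 * p + u$1$2 * q) * (u$1$1 * p' + u$1$2 * q')
       + cnj (u$2$1 * p + u$2$2 * q) * (u$2$1 * p' + u$2$2 * q') = cnj p * p' + cnj q * q'"
    (is "?l = _")
proof -
  have "?l = (cnj (u$1$1) * u$1$1 + cnj (u$2$1) * u$2$1) * (cnj p * p')
     + (cnj (u$1$2) * u$1$2 + cnj (u$2$2) * u$2$2) * (cnj q * q')
     + (cnj (u$1$1) * u$1$2 + cnj (u$2$1) * u$2$2) * (cnj p * q')
     + (cnj (u$1$2) * u$1$1 + cnj (u$2$2) * u$2$1) * (cnj q * p')"
    by (simp add: algebra_simps)
  then show ?thesis
    by (simp add: unitary_entries[OF assms])
qed

text \<open>\<open>X\<close> and \<open>CSWAP\<close> reindex the sum in \<open>braket\<close> along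
  an involution. An XX+YY gate acts by a unitary on each pair consisting of a basis state and its
  swap.\<close>

lemma gate_isometry:
  assumes u: "\<And>\<theta>. unitary (G \<theta>)" and Q: "finite Q" and g: "gate_on Q g"
  shows "braket Q (gate_op G g \<psi>) (gate_op G g \<eta>) = braket Q \<psi> \<eta>"
proof (cases g)
  case (X a)
  then show ?thesis
    using g braket_reindex[of "\<lambda>x. x(a := \<not> x a)" Q \<psi> \<eta>] by (simp add: basis_upd)
next
  case (CSWAP c a b)
  then show ?thesis
    using g braket_reindex[of "cswap_bits c a b" Q \<psi> \<eta>] by (auto simp: basis_upd fun_eq_iff)
next
  case (XXYY \<theta> a b)
  define \<tau> where "\<tau> = (\<lambda>x :: 'a bits. x(a := x b, b := x a))"
  have ab: "a \<noteq> b" "a \<in> Q" "b \<in> Q"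
    using g XXYY by auto
  \<comment> \<open>Summing twice, over each \<open>x\<close> and its partner
    \<open>\<tau> x\<close>, avoids choosing representatives of the pairs and also covers the fixed
    points of \<open>\<tau>\<close>.\<close>
  have double: "2 * braket Q \<psi> \<eta> = (\<Sum>x\<in>basis Q. cnj (\<psi> x) * \<eta> x + cnj (\<psi> (\<tau> x)) * \<eta> (\<tau> x))"
    for \<psi> \<eta> :: "'a state"
    using braket_reindex[of \<tau> Q \<psi> \<eta>] ab
    by (simp add: \<tau>_def basis_upd sum.distrib braket_def fun_eq_iff)
  have "cnj (gate_op G g \<psi> x) * gate_op G g \<eta> x + cnj (gate_op G g \<psi> (\<tau> x)) * gate_op G g \<eta> (\<tau> x)
      = cnj (\<psi> x) * \<eta> x + cnj (\<psi> (\<tau> x)) * \<eta> (\<tau> x)" for x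
  proof (cases "x a = x b")
    case True
    then have "\<tau> x = x" by (simp add: \<tau>_def fun_eq_iff)
    then show ?thesis using True XXYY by simp
  next
    case False
    define x01 x10 where "x01 = x(a := False, b := True)" and "x10 = x(a := True, b := False)"
    have op: "gate_op G g \<psi> x01 = G \<theta>$1$1 * \<psi> x01 + G \<theta>$1$2 * \<psi> x10"
      "gate_op G g \<psi> x10 = G \<theta>$2$1 * \<psi> x01 + G \<theta>$2$2 * \<psi> x10" for \<psi>
      using ab by (simp_all add: XXYY x01_def x10_def fun_upd_twist)
    have pair: "cnj (gate_op G g \<psi> x01) * gate_op G g \<eta> x01
        + cnj (gate_op G g \<psi> x10) * gate_op G g \<eta> x10 = cnj (\<psi> x01) * \<eta> x01 + cnj (\<psi> x10) * \<eta> x10"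
      unfolding op by (rule unitary_2d_isometry[OF u])
    have "(x = x01 \<and> \<tau> x = x10) \<or> (x = x10 \<and> \<tau> x = x01)"
      using False ab by (auto simp: \<tau>_def x01_def x10_def fun_eq_iff)
    then show ?thesis
      using pair by (elim disjE conjE) (simp_all only: add.commute)
  qed
  then have "2 * braket Q (gate_op G g \<psi>) (gate_op G g \<eta>) = 2 * braket Q \<psi> \<eta>"
    unfolding double by (rule sum.cong[OF refl])
  then show ?thesis by simp
qed

lemma run_isometry:
  assumes "\<And>\<theta>. unitary (G \<theta>)" "finite Q" "\<forall>g\<in>set c. gate_on Q g"
  shows "braket Q (run G c \<psi>) (run G c \<eta>) = braket Q \<psi> \<eta>"
  using assms(3)
  by (induction c arbitrary: \<psi> \<eta>) (simp_all add: run_def gate_isometry[OF assms(1,2)])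

text \<open>The matrix element at \<open>x\<close> is the inner product of the images of
  \<open>ket x\<close> and \<psi>, which the isometry turns back into
  \<open>\<psi> x\<close>.\<close>

lemma adj_run_run:
  assumes "\<And>\<theta>. unitary (G \<theta>)" "finite Q" "\<forall>g\<in>set c. gate_on Q g" "\<psi> \<in> supp (basis Q)"
  shows "adj Q (run G c) (run G c \<psi>) = \<psi>"
  using assms(4)
  by (auto simp: adj_def run_isometry[OF assms(1-3)] braket_ket[OF assms(2)] supp_def)

section \<open>Images of support spaces under gates and circuits\<close>

lemma supp_reindex:
  assumes "\<And>x. \<sigma> (\<sigma> x) = x"
  shows "(\<lambda>\<psi> x. \<psi> (\<sigma> x)) ` supp A = supp (\<sigma> ` A)"
proof
  show "(\<lambda>\<psi> x. \<psi> (\<sigma> x)) ` supp A \<subseteq> supp (\<sigma> ` A)"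
    by (auto simp: supp_def) (metis assms imageI)
  show "supp (\<sigma> ` A) \<subseteq> (\<lambda>\<psi> x. \<psi> (\<sigma> x)) ` supp A"
  proof
    fix \<psi> assume *: "\<psi> \<in> supp (\<sigma> ` A)"
    have "\<psi> = (\<lambda>x. (\<lambda>x. \<psi> (\<sigma> x)) (\<sigma> x))" by (simp add: assms)
    moreover have "(\<lambda>x. \<psi> (\<sigma> x)) \<in> supp A"
      using * by (auto simp: supp_def) (metis assms imageE)
    ultimately show "\<psi> \<in> (\<lambda>\<psi> x. \<psi> (\<sigma> x)) ` supp A" by (rule image_eqI)
  qed
qed

text \<open>The new amplitude at \<open>x\<close> is a combination of the old ones at
  \<open>x\<close> and at its swap. Since the swap is an involution preserving \<open>A\<close>,
  both lie outside \<open>A\<close> as soon as \<open>x\<close> does.\<close>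

lemma supp_XXYY_subset:
  assumes ab: "a \<noteq> b" and A: "\<And>x. x \<in> A \<Longrightarrow> x(a := x b, b := x a) \<in> A"
    and \<psi>: "\<psi> \<in> supp A"
  shows "gate_op G (XXYY \<theta> a b) \<psi> \<in> supp A"
  unfolding supp_def
proof (clarify)
  fix x assume x: "x \<notin> A"
  define y where "y = x(a := x b, b := x a)"
  have "y(a := y b, b := y a) = x" using ab by (auto simp: y_def)
  then have "y \<notin> A" using A[of y] x by metis
  have z: "\<psi> x = 0" "\<psi> y = 0" using \<psi> x \<open>y \<notin> A\<close> by (auto simp: supp_def)
  show "gate_op G (XXYY \<theta> a b) \<psi> x = 0"
  proof (cases "x a = x b")
    case False
    have "x(a := False, b := True) \<in> {x, y}" "x(a := True, b := False) \<in> {x, y}"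
      using False ab by (cases "x b"; simp add: y_def fun_eq_iff)+
    then have "\<psi> (x(a := False, b := True)) = 0" "\<psi> (x(a := True, b := False)) = 0"
      using z by (metis insertE singletonD)+
    then show ?thesis using z by (simp add: Let_def)
  qed (simp add: z)
qed

definition adj_mat :: "complex^2^2 \<Rightarrow> complex^2^2" where
  "adj_mat u = (\<chi> i j. cnj (u $ j $ i))"

text \<open>The same gate evaluated with the adjoint matrices is an inverse. Changing the matrix
  family rather than the angle works even if no angle of \<open>G\<close> realises the inverse
  matrix.\<close>

lemma XXYY_adj_mat:
  assumes "unitary (G \<theta>)" "a \<noteq> b"
  shows "gate_op G (XXYY \<theta> a b) (gate_op (\<lambda>\<theta>. adj_mat (G \<theta>)) (XXYY \<theta> a b) \<psi>) = \<psi>"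
proof
  fix x
  define x01 x10 where "x01 = x(a := False, b := True)" and "x10 = x(a := True, b := False)"
  let ?G' = "\<lambda>\<theta>. adj_mat (G \<theta>)"
  have op: "gate_op H (XXYY \<theta> a b) \<psi> x01 = H \<theta>$1$1 * \<psi> x01 + H \<theta>$1$2 * \<psi> x10"
    "gate_op H (XXYY \<theta> a b) \<psi> x10 = H \<theta>$2$1 * \<psi> x01 + H \<theta>$2$2 * \<psi> x10" for \<psi> H
    using assms(2) by (simp_all add: x01_def x10_def fun_upd_twist)
  show "gate_op G (XXYY \<theta> a b) (gate_op ?G' (XXYY \<theta> a b) \<psi>) x = \<psi> x"
  proof (cases "x a = x b")
    case False
    let ?u = "G \<theta>" and ?p = "\<psi> x01" and ?q = "\<psi> x10"
    have 1: "gate_op G (XXYY \<theta> a b) (gate_op ?G' (XXYY \<theta> a b) \<psi>) x01 = ?p"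
    proof -
      have "gate_op G (XXYY \<theta> a b) (gate_op ?G' (XXYY \<theta> a b) \<psi>) x01
        = (?u$1$1 * cnj (?u$1$1) + ?u$1$2 * cnj (?u$1$2)) * ?p
          + (?u$1$1 * cnj (?u$2$1) + ?u$1$2 * cnj (?u$2$2)) * ?q"
        unfolding op by (simp add: adj_mat_def algebra_simps)
      then show ?thesis by (simp add: unitary_entries[OF assms(1)])
    qed
    have 2: "gate_op G (XXYY \<theta> a b) (gate_op ?G' (XXYY \<theta> a b) \<psi>) x10 = ?q"
    proof -
      have "gate_op G (XXYY \<theta> a b) (gate_op ?G' (XXYY \<theta> a b) \<psi>) x10
        = (?u$2$1 * cnj (?u$1$1) + ?u$2$2 * cnj (?u$1$2)) * ?p
          + (?u$2$1 * cnj (?u$2$1) + ?u$2$2 * cnj (?u$2$2)) * ?q"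
        unfolding op by (simp add: adj_mat_def algebra_simps)
      then show ?thesis by (simp add: unitary_entries[OF assms(1)])
    qed
    have "x = x01 \<or> x = x10"
      using False by (auto simp: x01_def x10_def fun_eq_iff)
    with 1 2 show ?thesis by metis
  qed simp
qed

text \<open>The gate and its inverse both map \<open>supp A\<close> into itself, so the inclusion is
  an equality.\<close>

lemma supp_XXYY:
  assumes "unitary (G \<theta>)" "a \<noteq> b" "\<And>x. x \<in> A \<Longrightarrow> x(a := x b, b := x a) \<in> A"
  shows "gate_op G (XXYY \<theta> a b) ` supp A = supp A"
proof
  show "gate_op G (XXYY \<theta> a b) ` supp A \<subseteq> supp A"
    using supp_XXYY_subset[OF assms(2,3)] by blast
  show "supp A \<subseteq> gate_op G (XXYY \<theta> a b) ` supp A"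
  proof
    fix \<psi> assume "\<psi> \<in> supp A"
    then have "gate_op (\<lambda>\<theta>. adj_mat (G \<theta>)) (XXYY \<theta> a b) \<psi> \<in> supp A"
      by (intro supp_XXYY_subset assms(2,3))
    then show "\<psi> \<in> gate_op G (XXYY \<theta> a b) ` supp A"
      by (metis XXYY_adj_mat[of G, OF assms(1,2)] imageI)
  qed
qed

text \<open>Equality of the image, not mere inclusion, is demanded because every feasible state must
  later be written as the image of a state with known support.\<close>

definition carries ::
  "(real \<Rightarrow> complex^2^2) \<Rightarrow> 'q set \<Rightarrow> 'q gate list \<Rightarrow> 'q bits set \<Rightarrow> 'q bits set \<Rightarrow> bool" where
  "carries G Q c A B \<longleftrightarrow> run G c ` supp A = supp B \<and> (\<forall>g\<in>set c. gate_on Q g)"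

lemma carries_Nil [simp]: "carries G Q [] A A"
  by (simp add: carries_def run_def)

lemma carries_append:
  assumes "carries G Q c A B" "carries G Q d B C"
  shows "carries G Q (c @ d) A C"
proof -
  have "run G (c @ d) ` supp A = run G d ` run G c ` supp A"
    by (simp add: run_def image_image)
  then show ?thesis using assms by (auto simp: carries_def)
qed

lemma carries_single:
  "carries G Q [g] A B \<longleftrightarrow> gate_op G g ` supp A = supp B \<and> gate_on Q g"
  by (auto simp: carries_def run_def)

lemma carries_Cons:
  assumes "carries G Q [g] A B" "carries G Q d B C"
  shows "carries G Q (g # d) A C"
  using carries_append[OF assms] by simp

lemma carries_upt:
  assumes "\<And>i. i < m \<Longrightarrow> carries G Q (c i) (S i) (S (Suc i))"
  shows "carries G Q (concat (map c [0..<m])) (S 0) (S m)"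
  using assms
proof (induction m)
  case (Suc m)
  then have "carries G Q (concat (map c [0..<m]) @ c m) (S 0) (S (Suc m))"
    by (intro carries_append[of _ _ _ _ "S m"]) auto
  then show ?case by simp
qed simp

lemma carries_downt:
  assumes "\<And>i. i < m \<Longrightarrow> carries G Q (c i) (S (Suc i)) (S i)"
  shows "carries G Q (concat (map c (rev [0..<m]))) (S m) (S 0)"
  using assms
proof (induction m)
  case (Suc m)
  then have "carries G Q (c m @ concat (map c (rev [0..<m]))) (S (Suc m)) (S 0)"
    by (intro carries_append[of _ _ _ _ "S m"]) auto
  then show ?case by simp
qed simp

lemma carries_CSWAP:
  assumes "a \<in> Q" "b \<in> Q" "c \<noteq> a" "c \<noteq> b"
  shows "carries G Q [CSWAP c a b] A (cswap_bits c a b ` A)"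
proof -
  have "gate_op G (CSWAP c a b) ` supp A = (\<lambda>\<psi> x. \<psi> (cswap_bits c a b x)) ` supp A"
    by (intro image_cong) auto
  also have "\<dots> = supp (cswap_bits c a b ` A)"
    using assms by (intro supp_reindex) (auto simp: fun_eq_iff)
  finally show ?thesis using assms by (simp add: carries_single)
qed

lemma carries_X:
  assumes "a \<in> Q"
  shows "carries G Q [X a] A ((\<lambda>x. x(a := \<not> x a)) ` A)"
proof -
  have "gate_op G (X a) ` supp A = (\<lambda>\<psi> x. \<psi> (x(a := \<not> x a))) ` supp A"
    by (intro image_cong) auto
  also have "\<dots> = supp ((\<lambda>x. x(a := \<not> x a)) ` A)"
    by (intro supp_reindex) (auto simp: fun_eq_iff)
  finally show ?thesis using assms by (simp add: carries_single)
qed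

section \<open>Register configurations\<close>

lemma concat_concat_map: "concat (concat (map f xs)) = concat (map (\<lambda>x. concat (f x)) xs)"
  by (induction xs) auto

lemma map_nth_upt: "map ((!) xs) [i..<length xs] = drop i xs"
  by (rule nth_equalityI) auto

locale tree_circuit =
  fixes M N rt :: nat and E :: "(nat \<times> nat) set"
    and G :: "real \<Rightarrow> complex^2^2" and ang :: "nat \<Rightarrow> nat \<Rightarrow> real"
  assumes N: "N \<ge> 1"
    and tree: "rooted_tree M E rt"
    and unitary: "\<And>\<theta>. unitary (G \<theta>)"
begin

abbreviation "Q \<equiv> qubits M N"

abbreviation "moves \<equiv> carries G Q"

text \<open>
  A basis state is coded by the position \<open>k r\<close> of the 1 in each register \<open>r\<close>.  The registers
  outside \<open>V\<close> still await their \<open>X\<close> gate, which flips qubit 0; they are all 0 if \<open>k r = 0\<close>.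
\<close>

definition enc :: "nat set \<Rightarrow> (nat \<Rightarrow> nat) \<Rightarrow> (nat \<times> nat) bits" where
  "enc V k = (\<lambda>q\<in>Q. (snd q = k (fst q)) \<noteq> (fst q \<notin> V \<and> snd q = 0))"

lemma enc_apply:
  "r \<in> {1..M} \<Longrightarrow> i < N \<Longrightarrow> enc V k (r, i) \<longleftrightarrow> (i = k r) \<noteq> (r \<notin> V \<and> i = 0)"
  by (simp add: enc_def qubits_def)

lemma enc_in_basis: "enc V k \<in> basis Q"
  by (simp add: enc_def basis_def)

lemma enc_X:
  assumes "r \<in> {1..M}" "r \<notin> V"
  shows "(enc V k)((r, 0) := \<not> enc V k (r, 0)) = enc (insert r V) k"
  using assms N by (auto simp: enc_def qubits_def fun_eq_iff)

lemma enc_swap: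
  assumes "r \<in> {1..M}" "r \<in> V" "i < N" "j < N"
  shows "(enc V k)((r, i) := enc V k (r, j), (r, j) := enc V k (r, i))
    = enc V (k(r := Transposition.transpose i j (k r)))"
  using assms by (auto simp: enc_def qubits_def fun_eq_iff Transposition.transpose_def)

text \<open>The \<open>X\<close> gate initialises register \<open>r\<close>. Every later gate mixes
  positions \<open>i\<close> and 0, both below \<open>n\<close>, and \<open>K\<close> is closed
  under changing \<open>k r\<close> below \<open>n\<close>, hence under the transposition of
  \<open>i\<close> and 0. For \<open>n = 0\<close> the set \<open>K\<close> is empty.\<close>

lemma moves_W:
  assumes r: "r \<in> {1..M}" "r \<notin> V" and n: "n \<le> N"
    and K: "\<And>k l. k \<in> K \<Longrightarrow> k r < n \<Longrightarrow> l < n \<Longrightarrow> k(r := l) \<in> K" "\<And>k. k \<in> K \<Longrightarrow> k r < n"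
  shows "moves (W_circ ang (Pair r) n) (enc V ` K) (enc (insert r V) ` K)"
proof -
  let ?A = "enc (insert r V) ` K"
  have "(\<lambda>x. x((r, 0) := \<not> x (r, 0))) ` enc V ` K = ?A"
    using enc_X[OF r] by (simp add: image_image)
  then have X: "moves [X (r, 0)] (enc V ` K) ?A"
    using carries_X[of "(r, 0)" Q G "enc V ` K"] r N by (simp add: qubits_def)
  have "moves [XXYY \<theta> (r, i) (r, 0)] ?A ?A" if i: "1 \<le> i" "i < n" for i \<theta>
    unfolding carries_single
  proof
    have "x((r, i) := x (r, 0), (r, 0) := x (r, i)) \<in> ?A" if "x \<in> ?A" for x
    proof -
      obtain k where k: "k \<in> K" "x = enc (insert r V) k" using \<open>x \<in> ?A\<close> by auto
      then have "x((r, i) := x (r, 0), (r, 0) := x (r, i)) = enc (insert r V) (k(r := Transposition.transpose i 0 (k r)))"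
        using enc_swap[of r "insert r V" i 0 k] r i n by simp
      moreover have "k(r := Transposition.transpose i 0 (k r)) \<in> K"
        using k K i by (intro K(1)) (auto simp: Transposition.transpose_def)
      ultimately show ?thesis by simp
    qed
    then show "gate_op G (XXYY \<theta> (r, i) (r, 0)) ` supp ?A = supp ?A"
      using i by (intro supp_XXYY unitary) auto
    show "gate_on Q (XXYY \<theta> (r, i) (r, 0))"
      using i n r by (auto simp: qubits_def)
  qed
  then have "moves [XXYY (ang n i) (r, i) (r, 0). i \<leftarrow> is] ?A ?A" if "set is \<subseteq> {1..<n}" for "is"
    using that by (induction "is") (auto intro: carries_Cons)
  then have "moves [XXYY (ang n i) (r, i) (r, 0). i \<leftarrow> [1..<n]] ?A ?A"
    by simp
  then show ?thesis
    unfolding W_circ_def by (intro carries_Cons[OF X])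
qed

text \<open>Joint effect of the make-distinct circuits controlled by \<open>r\<close> on all
  registers in \<open>J\<close>. The controls only range over positions below \<open>n\<close>,
  whence the guard.\<close>

definition distinguish :: "nat \<Rightarrow> nat \<Rightarrow> nat set \<Rightarrow> (nat \<Rightarrow> nat) \<Rightarrow> nat \<Rightarrow> nat" where
  "distinguish r n J k = (\<lambda>s. if s \<in> J \<and> k r < n then Transposition.transpose n (k r) (k s) else k s)"

text \<open>Register \<open>r\<close> holds a single 1 and is never changed, so the only swap that
  can fire is the one controlled on qubit \<open>k r\<close>.\<close>

lemma moves_D:
  assumes rs: "r \<in> {1..M}" "s \<in> {1..M}" "r \<in> V" "s \<in> V" "r \<noteq> s" and n: "n < N"
  shows "moves (D_circ (Pair r) (Pair s) n) (enc V ` K) (enc V ` distinguish r n {s} ` K)"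
proof -
  \<comment> \<open>\<open>d i\<close> is the effect of the first \<open>i\<close> controlled swaps;
    it is the identity for \<open>i = 0\<close> and \<open>distinguish r n {s}\<close> for
    \<open>i = n\<close>.\<close>
  define d where "d i k = k(s := if k r < i then Transposition.transpose n (k r) (k s) else k s)"
    for i and k :: "nat \<Rightarrow> nat"
  have step: "cswap_bits (r, i) (s, n) (s, i) (enc V (d i k)) = enc V (d (Suc i) k)"
    if "i < n" for i k
  proof -
    have c: "enc V (d i k) (r, i) \<longleftrightarrow> i = k r"
      using enc_apply[of r i V "d i k"] rs that n by (auto simp: d_def)
    show ?thesis
    proof (cases "k r = i")
      case True
      then show ?thesis
        using c enc_swap[of s V n i "d i k"] rs that n by (simp add: d_def)
    next
      case False
      then have "d i k = d (Suc i) k" by (auto simp: d_def)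
      then show ?thesis using c False by simp
    qed
  qed
  have "moves (concat (map (\<lambda>i. [CSWAP (r, i) (s, n) (s, i)]) [0..<n])) (enc V ` d 0 ` K) (enc V ` d n ` K)"
  proof (rule carries_upt)
    fix i assume i: "i < n"
    have "cswap_bits (r, i) (s, n) (s, i) ` enc V ` d i ` K = enc V ` d (Suc i) ` K"
      unfolding image_image using step[OF i] by (intro image_cong) (simp_all del: cswap_bits.simps)
    then show "moves [CSWAP (r, i) (s, n) (s, i)] (enc V ` d i ` K) (enc V ` d (Suc i) ` K)"
      using carries_CSWAP[of "(s, n)" Q "(s, i)" "(r, i)" G "enc V ` d i ` K"] rs n i
      by (simp add: qubits_def)
  qed
  moreover have "d 0 ` K = K" "d n = distinguish r n {s}"
    by (auto simp: d_def distinguish_def fun_eq_iff)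
  ultimately show ?thesis
    by (simp add: D_circ_def)
qed

lemma moves_Ds:
  assumes "r \<in> {1..M}" "r \<in> V" "n < N"
    and "set js \<subseteq> {1..M} \<inter> V - {r}" "distinct js"
  shows "moves (concat (map (\<lambda>s. D_circ (Pair r) (Pair s) n) js))
    (enc V ` K) (enc V ` distinguish r n (set js) ` K)"
  using assms(4,5)
proof (induction js arbitrary: K)
  case Nil
  have "distinguish r n {} = id" by (simp add: distinguish_def fun_eq_iff)
  then show ?case by simp
next
  case (Cons s js)
  have eq: "distinguish r n (set (s # js)) ` K = distinguish r n (set js) ` distinguish r n {s} ` K"
    unfolding image_image
    by (intro image_cong) (use Cons.prems in \<open>auto simp: distinguish_def fun_eq_iff\<close>)
  have "moves (D_circ (Pair r) (Pair s) n) (enc V ` K) (enc V ` distinguish r n {s} ` K)"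
    using Cons.prems assms by (intro moves_D) auto
  from carries_append[OF this Cons.IH] show ?case
    using Cons.prems unfolding eq by simp
qed

text \<open>
  If \<open>k s < n\<close>, then \<open>distinguish\<close> moves \<open>k s\<close> to the free position \<open>n\<close> exactly when it equals \<open>k r\<close>.
\<close>

lemma distinguish_image:
  assumes r: "r \<notin> J"
    and indep: "\<And>k k'. k \<in> R \<Longrightarrow> (\<And>s. s \<notin> J \<Longrightarrow> k' s = k s) \<Longrightarrow> k' \<in> R"
    and le: "\<And>k. k \<in> R \<Longrightarrow> k r \<le> n"
  shows "distinguish r n J ` {k \<in> R. inj_on k J \<and> (\<forall>s\<in>J. k s < n)}
    = {k \<in> R. inj_on k J \<and> (\<forall>s\<in>J. k s \<le> n \<and> k s \<noteq> k r)}" (is "?d ` ?A = ?B")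
proof -
  have val: "?d k s = (if s \<in> J then Transposition.transpose n (k r) (k s) else k s)" if "k \<in> R" for k s
    using le[OF that] by (auto simp: distinguish_def)
  have inR: "?d k \<in> R" if "k \<in> R" for k
    by (rule indep[OF that]) (simp add: distinguish_def)
  have inj: "inj_on (?d k) J \<longleftrightarrow> inj_on k J" if "k \<in> R" for k
    unfolding inj_on_def using that by (simp add: val inj_eq[OF inj_transpose])
  have fixr: "?d k r = k r" for k
    using r by (simp add: distinguish_def)
  \<comment> \<open>The map fixes \<open>k r\<close>, so applying it twice applies the same
    transposition twice. The image equality then reduces to two inclusions for the same map.\<close>
  have invol: "?d (?d k) = k" if "k \<in> R" for k
    by (rule ext) (simp add: that inR val fixr)
  have AB: "?d k \<in> ?B" if "k \<in> ?A" for k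
  proof -
    have "?d k s \<le> n \<and> ?d k s \<noteq> k r" if "s \<in> J" for s
    proof -
      have "?d k s = (if k s = k r then n else k s)" "k s < n"
        using \<open>k \<in> ?A\<close> that by (auto simp: val Transposition.transpose_def)
      then show ?thesis by auto
    qed
    then show ?thesis using that by (simp add: inR inj fixr)
  qed
  have BA: "?d k \<in> ?A" if "k \<in> ?B" for k
  proof -
    have "?d k s < n" if "s \<in> J" for s
    proof -
      have "?d k s = (if k s = n then k r else k s)" "k s \<le> n" "k s \<noteq> k r" "k r \<le> n"
        using \<open>k \<in> ?B\<close> that le by (auto simp: val Transposition.transpose_def)
      then show ?thesis by auto
    qed
    then show ?thesis using that by (simp add: inR inj)
  qed
  show ?thesis
  proof
    show "?d ` ?A \<subseteq> ?B" using AB by blast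
    show "?B \<subseteq> ?d ` ?A"
    proof
      fix k assume k: "k \<in> ?B"
      then have "k = ?d (?d k)" using invol by simp
      then show "k \<in> ?d ` ?A" using BA[OF k] by (rule image_eqI)
    qed
  qed
qed

section \<open>The tree\<close>

lemma E_in: "(r, s) \<in> E \<Longrightarrow> r \<in> {1..M} \<and> s \<in> {1..M}"
  and rt_in: "rt \<in> {1..M}"
  and rt_no_edge: "(rt, s) \<notin> E"
  and to_rt: "r \<in> {1..M} \<Longrightarrow> (r, rt) \<in> E\<^sup>*"
  using tree by (auto simp: rooted_tree_def)

lemma parent_unique: "(r, s) \<in> E \<Longrightarrow> (r, t) \<in> E \<Longrightarrow> s = t"
  using tree E_in[of r s] rt_no_edge unfolding rooted_tree_def by blast

lemma parent_exists:
  assumes "r \<in> {1..M}" "r \<noteq> rt"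
  obtains s where "(r, s) \<in> E"
proof -
  have "\<exists>!s. (r, s) \<in> E"
    using tree assms by (simp add: rooted_tree_def)
  then show ?thesis using that by blast
qed

lemma finite_E: "finite E" and acyclic_E: "acyclic E"
  using rooted_tree_acyclic[OF tree] by auto

lemma edge_irrefl: "(r, r) \<notin> E"
  using acyclic_E by (auto simp: acyclic_def)

lemma finite_pred: "finite (pred E x)"
  by (rule finite_subset[of _ "{1..M}"]) (use E_in in \<open>auto simp: pred_def\<close>)

definition subtree :: "nat \<Rightarrow> nat set" where
  "subtree x = {y. (y, x) \<in> E\<^sup>*}"

lemma subtree_unfold: "subtree x = insert x (\<Union>(subtree ` pred E x))"
  by (auto simp: subtree_def pred_def elim: rtranclE intro: rtrancl_into_rtrancl)

text \<open>Parents are unique, so the nodes reachable from \<open>z\<close> form a chain.\<close>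

lemma ancestors_comparable:
  assumes "(z, p) \<in> E\<^sup>*" "(z, q) \<in> E\<^sup>*"
  shows "(p, q) \<in> E\<^sup>* \<or> (q, p) \<in> E\<^sup>*"
  using assms
proof (induction rule: rtrancl_induct)
  case (step y w)
  then show ?case
    by (metis converse_rtranclE parent_unique r_into_rtrancl rtrancl_trans)
qed simp

text \<open>A nontrivial path from \<open>p\<close> to \<open>q\<close> starts with the edge to the
  common parent \<open>x\<close>; the edge from \<open>q\<close> to \<open>x\<close> would then
  close a cycle.\<close>

lemma sibling_not_ancestor:
  assumes "(p, x) \<in> E" "(q, x) \<in> E" "(p, q) \<in> E\<^sup>*"
  shows "p = q"
proof (rule ccontr)
  assume "p \<noteq> q"
  then obtain w where "(p, w) \<in> E" "(w, q) \<in> E\<^sup>*"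
    using assms(3) by (meson converse_rtranclE)
  then have "(x, x) \<in> E\<^sup>+"
    using assms parent_unique[of p x w] by (metis rtrancl_into_trancl1)
  then show False using acyclic_E by (auto simp: acyclic_def)
qed

lemma subtree_disjoint:
  assumes "p \<in> pred E x" "q \<in> pred E x" "p \<noteq> q"
  shows "subtree p \<inter> subtree q = {}"
proof -
  have False if "(z, p) \<in> E\<^sup>*" "(z, q) \<in> E\<^sup>*" for z
    using ancestors_comparable[OF that] sibling_not_ancestor[of p x q] sibling_not_ancestor[of q x p] assms
    unfolding pred_def by blast
  then show ?thesis unfolding subtree_def by blast
qed

lemma not_in_child_subtree:
  assumes "p \<in> pred E x"
  shows "x \<notin> subtree p"
  using assms acyclic_E by (auto simp: subtree_def pred_def acyclic_def dest: rtrancl_into_trancl1)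

lemma subtree_rt: "subtree rt = {1..M}"
  using to_rt rt_in E_in by (auto simp: subtree_def elim: converse_rtranclE)

section \<open>The preparation circuit\<close>

text \<open>
  \<open>visited Y\<close> are the registers already initialised once the nodes in \<open>Y\<close> have been expanded, and
  \<open>enc (visited Y) ` conf Y\<close> are the basis states spanning the space reached at that point.
\<close>

definition visited :: "nat set \<Rightarrow> nat set" where
  "visited Y = insert rt (\<Union>(pred E ` Y))"

text \<open>The cardinality is the index of \<open>r\<close> in the sorted list of children of its
  parent, expressed without naming that parent.\<close>

definition bound :: "nat \<Rightarrow> nat" where
  "bound r = (if r = rt then N else N - 1 - card {s. s < r \<and> (\<exists>p. (r, p) \<in> E \<and> (s, p) \<in> E)})"

text \<open>The part of (C2) and (C3) that concerns the edges into \<open>y\<close>. Writing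
  \<open>k r \<le> N - 1\<close> instead of \<open>k r < N\<close> matches the form delivered by
  \<open>distinguish_image\<close>.\<close>

definition proper :: "nat \<Rightarrow> (nat \<Rightarrow> nat) \<Rightarrow> bool" where
  "proper y k \<longleftrightarrow> inj_on k (pred E y) \<and> (\<forall>r\<in>pred E y. k r \<le> N - 1 \<and> k r \<noteq> k y)"

definition conf :: "nat set \<Rightarrow> (nat \<Rightarrow> nat) set" where
  "conf Y = {k. k rt < N \<and> (\<forall>y\<in>Y. proper y k) \<and> (\<forall>r\<in>{1..M} - visited Y. k r < bound r)}"

text \<open>The smaller siblings of the entry at index \<open>i\<close> are exactly the
  \<open>i\<close> entries before it.\<close>

lemma sorted_pred_nth:
  assumes "i < length (sorted_list_of_set (pred E x))"
  shows "bound (sorted_list_of_set (pred E x) ! i) = N - 1 - i"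
proof -
  define P where "P = sorted_list_of_set (pred E x)"
  have P: "set P = pred E x" "sorted_wrt (<) P" "i < length P"
    using assms finite_pred by (simp_all add: P_def)
  have lt: "P ! a < P ! b" if "a < b" "b < length P" for a b
    using that P(2) by (simp add: sorted_wrt_nth_less)
  have Pi: "(P ! i, x) \<in> E"
    using P nth_mem[of i P] by (simp add: pred_def)
  have "{s. s < P ! i \<and> (\<exists>p. (P ! i, p) \<in> E \<and> (s, p) \<in> E)} = {s \<in> set P. s < P ! i}"
    using Pi parent_unique by (auto simp: P(1) pred_def)
  also have "\<dots> = (!) P ` {..<i}"
  proof
    show "{s \<in> set P. s < P ! i} \<subseteq> (!) P ` {..<i}"
      using lt by (auto simp: in_set_conv_nth) (metis imageI lessThan_iff linorder_neqE_nat order_less_asym)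
    show "(!) P ` {..<i} \<subseteq> {s \<in> set P. s < P ! i}"
      using lt P(3) by auto
  qed
  also have "card \<dots> = i"
  proof -
    have "inj_on ((!) P) {..<i}"
      using P by (intro inj_on_nth) (auto simp: strict_sorted_iff)
    then show ?thesis by (simp add: card_image)
  qed
  finally show ?thesis
    using Pi rt_no_edge by (auto simp: bound_def P_def)
qed

section \<open>Expansion of a single node and recursion over the tree\<close>

definition expand_circ :: "nat \<Rightarrow> (nat \<times> nat) gate list" where
  "expand_circ x = (let P = sorted_list_of_set (pred E x); m = length P in
     concat [W_circ ang (Pair (P ! i)) (N - 1 - i). i \<leftarrow> [0..<m]] @
     concat [D_circ (Pair (P ! i)) (Pair (P ! j)) (N - 2 - i). i \<leftarrow> rev [0..<m - 1], j \<leftarrow> [i + 1..<m]] @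
     concat [D_circ (Pair x) (Pair (P ! i)) (N - 1). i \<leftarrow> [0..<m]])"

lemma A_circ_expand:
  "A_circ ang E N x = expand_circ x @ concat (map (A_circ ang E N) (sorted_list_of_set (pred E x)))"
  by (subst A_circ.simps) (simp add: finite_E acyclic_E expand_circ_def Let_def)

text \<open>The three loops act in turn: the first initialises the children within their bounds, the
  second makes them pairwise distinct below \<open>N - 1\<close>, and the third uses the free
  position \<open>N - 1\<close> to separate them from \<open>x\<close>.\<close>

lemma moves_expand:
  assumes x: "x \<in> visited Y" "x \<notin> Y" and Y: "Y \<subseteq> visited Y"
  shows "moves (expand_circ x) (enc (visited Y) ` conf Y)
    (enc (visited (insert x Y)) ` conf (insert x Y))"
proof -
  define P where "P = sorted_list_of_set (pred E x)"
  define m where "m = length P"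
  define V where "V = visited Y"
  have P: "set P = pred E x" "distinct P"
    using finite_pred by (simp_all add: P_def)
  have V': "visited (insert x Y) = V \<union> set P"
    by (auto simp: V_def visited_def P)
  have V_in: "V \<subseteq> {1..M}"
    using rt_in E_in by (auto simp: V_def visited_def pred_def)
  have P_in: "set P \<subseteq> {1..M}"
    using E_in by (auto simp: P pred_def)
  have disj: "set P \<inter> V = {}"
    using parent_unique x(2) rt_no_edge by (auto simp: P V_def visited_def pred_def)
  have xP: "x \<notin> set P" using disj x by (auto simp: V_def)
  have x_in: "x \<in> {1..M}" using x V_in by (auto simp: V_def)
  \<comment> \<open>\<open>R\<close> collects the conditions shared by \<open>conf Y\<close> and
    \<open>conf (insert x Y)\<close>; none of them reads the register of a child of
    \<open>x\<close>.\<close>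
  define R where "R = {k. k rt < N \<and> (\<forall>y\<in>Y. proper y k) \<and> (\<forall>r\<in>{1..M} - (V \<union> set P). k r < bound r)}"
  have R_indep: "k' \<in> R" if "k \<in> R" "\<And>s. s \<notin> set P \<Longrightarrow> k' s = k s" for k k'
  proof -
    \<comment> \<open>The conditions for nodes of \<open>Y\<close> only read registers in
      \<open>visited Y\<close>, which contains no child of \<open>x\<close>.\<close>
    have "k' s = k s" if "s \<in> V" for s
      using that disj \<open>\<And>s. s \<notin> set P \<Longrightarrow> k' s = k s\<close> by blast
    then have "k' rt = k rt" "\<And>y. y \<in> Y \<Longrightarrow> k' y = k y" "\<And>y r. y \<in> Y \<Longrightarrow> r \<in> pred E y \<Longrightarrow> k' r = k r"
      using Y by (auto simp: V_def visited_def)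
    moreover from this have "proper y k' \<longleftrightarrow> proper y k" if "y \<in> Y" for y
      using that by (simp add: proper_def inj_on_def)
    ultimately show ?thesis using that by (simp add: R_def)
  qed
  have R_upd: "k(s := l) \<in> R" if "k \<in> R" "s \<in> set P" for k s l
    by (rule R_indep[OF that(1)]) (use that(2) in auto)
  have R_x: "k x \<le> N - 1" if "k \<in> R" for k
  proof (cases "x = rt")
    case False
    then obtain y where "y \<in> Y" "x \<in> pred E y" using x by (auto simp: visited_def)
    then show ?thesis using that by (auto simp: R_def proper_def)
  qed (use that in \<open>auto simp: R_def\<close>)
  have start: "conf Y = {k \<in> R. \<forall>i<m. k (P ! i) < N - 1 - i}"
  proof -
    have "{1..M} - V = ({1..M} - (V \<union> set P)) \<union> set P"
      using disj P_in by auto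
    then have "conf Y = {k \<in> R. \<forall>r\<in>set P. k r < bound r}"
      by (auto simp: conf_def R_def simp flip: V_def)
    moreover have "(\<forall>r\<in>set P. k r < bound r) \<longleftrightarrow> (\<forall>i<m. k (P ! i) < N - 1 - i)" for k
      using sorted_pred_nth[of _ x] by (simp add: all_set_conv_all_nth m_def P_def)
    ultimately show ?thesis by simp
  qed
  have finish: "conf (insert x Y) = {k \<in> R. inj_on k (set P) \<and> (\<forall>s\<in>set P. k s \<le> N - 1 \<and> k s \<noteq> k x)}"
    by (auto simp: conf_def R_def V' proper_def P)
  have s1: "moves (concat (map (\<lambda>i. W_circ ang (Pair (P ! i)) (N - 1 - i)) [0..<m]))
      (enc V ` conf Y) (enc (V \<union> set P) ` conf Y)"
  proof -
    \<comment> \<open>The set of configurations stays fixed; only the set of initialised registers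
      grows.\<close>
    let ?S = "\<lambda>i. enc (V \<union> set (take i P)) ` conf Y"
    have "moves (concat (map (\<lambda>i. W_circ ang (Pair (P ! i)) (N - 1 - i)) [0..<m])) (?S 0) (?S m)"
    proof (rule carries_upt)
      fix i assume i: "i < m"
      have "P ! i \<in> set P" using i by (simp add: m_def)
      then have "P ! i \<in> {1..M}" "P ! i \<notin> V" "P ! i \<in> set P"
        using P_in disj by blast+
      moreover have "P ! i \<notin> set (take i P)"
        using i P(2) by (auto simp: in_set_conv_nth m_def nth_eq_iff_index_eq)
      ultimately have "moves (W_circ ang (Pair (P ! i)) (N - 1 - i)) (?S i)
          (enc (insert (P ! i) (V \<union> set (take i P))) ` conf Y)"
        using i P(2) by (intro moves_W) (auto simp: start R_upd m_def nth_eq_iff_index_eq)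
      moreover have "insert (P ! i) (V \<union> set (take i P)) = V \<union> set (take (Suc i) P)"
        using i by (simp add: take_Suc_conv_app_nth m_def)
      ultimately show "moves (W_circ ang (Pair (P ! i)) (N - 1 - i)) (?S i) (?S (Suc i))"
        by simp
    qed
    then show ?thesis by (simp add: m_def)
  qed
  have s2: "moves (concat (map (\<lambda>i. concat (map (\<lambda>j. D_circ (Pair (P ! i)) (Pair (P ! j)) (N - 2 - i)) [i + 1..<m])) (rev [0..<m - 1])))
      (enc (V \<union> set P) ` conf Y)
      (enc (V \<union> set P) ` {k \<in> R. inj_on k (set P) \<and> (\<forall>s\<in>set P. k s < N - 1)})"
    (is "moves ?c _ _")
  proof -
    \<comment> \<open>In the state \<open>K i\<close> the children from \<open>i\<close> on are distinct and have the bound of child \<open>i\<close>.\<close>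
    define K where "K i = {k \<in> R. (\<forall>l<i. k (P ! l) < N - 1 - l) \<and> inj_on k (set (drop i P))
        \<and> (\<forall>s\<in>set (drop i P). k s < N - 1 - i)}" for i
    let ?S = "\<lambda>i. enc (V \<union> set P) ` K i"
    have "moves ?c (?S (m - 1)) (?S 0)"
    proof (rule carries_downt)
      fix i assume "i < m - 1"
      then have i: "i < length P" by (simp add: m_def)
      define J where "J = set (drop (Suc i) P)"
      \<comment> \<open>The circuits controlled by child \<open>i\<close> change only the later
        children \<open>J\<close>, so the bounds up to index \<open>i\<close> can join the untouched
        conditions.\<close>
      define Ri where "Ri = {k \<in> R. \<forall>l\<le>i. k (P ! l) < N - 1 - l}"
      have J: "P ! l \<notin> J" if "l \<le> i" for l
        using that i P(2) by (auto simp: J_def in_set_conv_nth nth_eq_iff_index_eq)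
      have JP: "J \<subseteq> set P" by (auto simp: J_def dest: in_set_dropD)
      have drop: "set (drop i P) = insert (P ! i) J"
        using i by (simp add: J_def Cons_nth_drop_Suc[symmetric])
      have K_Suc: "K (Suc i) = {k \<in> Ri. inj_on k J \<and> (\<forall>s\<in>J. k s < N - 2 - i)}"
        by (auto simp: K_def Ri_def J_def less_Suc_eq_le numeral_2_eq_2)
      have K_i: "K i = {k \<in> Ri. inj_on k J \<and> (\<forall>s\<in>J. k s \<le> N - 2 - i \<and> k s \<noteq> k (P ! i))}"
      proof -
        have "k \<in> K i \<longleftrightarrow> k \<in> Ri \<and> inj_on k J \<and> (\<forall>s\<in>J. k s < N - 1 - i \<and> k s \<noteq> k (P ! i))" for k
          using J[of i] unfolding K_def Ri_def drop by (auto simp: le_less image_iff)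
        \<comment> \<open>Subtraction is truncated, so the two bounds agree only when
          \<open>N - 1 - i\<close> is positive; the position of child \<open>i\<close> witnesses
          this.\<close>
        moreover have "a < N - 1 - i \<longleftrightarrow> a \<le> N - 2 - i" if "k \<in> Ri" for k a
        proof -
          have "k (P ! i) < N - 1 - i" using that by (simp add: Ri_def)
          then show ?thesis by linarith
        qed
        ultimately show ?thesis by auto
      qed
      have img: "distinguish (P ! i) (N - 2 - i) J ` K (Suc i) = K i"
        unfolding K_Suc K_i
      proof (rule distinguish_image)
        show "P ! i \<notin> J" by (rule J) simp
        show "k' \<in> Ri" if k: "k \<in> Ri" and eq: "\<And>s. s \<notin> J \<Longrightarrow> k' s = k s" for k k'
        proof -
          have "k' \<in> R"
          proof (rule R_indep)
            show "k \<in> R" using k by (simp add: Ri_def)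
            show "k' s = k s" if "s \<notin> set P" for s
              using that JP by (intro eq) blast
          qed
          then show ?thesis using k eq[OF J] by (simp add: Ri_def)
        qed
        show "k (P ! i) \<le> N - 2 - i" if "k \<in> Ri" for k
        proof -
          have "k (P ! i) < N - 1 - i" using that by (simp add: Ri_def)
          then show ?thesis by linarith
        qed
      qed
      have "moves (concat (map (\<lambda>s. D_circ (Pair (P ! i)) (Pair s) (N - 2 - i)) (drop (Suc i) P)))
          (?S (Suc i)) (enc (V \<union> set P) ` distinguish (P ! i) (N - 2 - i) J ` K (Suc i))"
        unfolding J_def
      proof (rule moves_Ds)
        show "P ! i \<in> {1..M}" "P ! i \<in> V \<union> set P" using i P_in nth_mem[of i P] by blast+
        show "set (drop (Suc i) P) \<subseteq> {1..M} \<inter> (V \<union> set P) - {P ! i}"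
          using J[of i] JP P_in by (auto simp: J_def)
        show "distinct (drop (Suc i) P)" using P(2) by simp
        show "N - 2 - i < N" using N by simp
      qed
      moreover have "map (\<lambda>j. D_circ (Pair (P ! i)) (Pair (P ! j)) (N - 2 - i)) [i + 1..<m]
          = map (\<lambda>s. D_circ (Pair (P ! i)) (Pair s) (N - 2 - i)) (drop (Suc i) P)"
        unfolding m_def map_nth_upt[symmetric] by simp
      ultimately show "moves (concat (map (\<lambda>j. D_circ (Pair (P ! i)) (Pair (P ! j)) (N - 2 - i)) [i + 1..<m]))
          (?S (Suc i)) (?S i)"
        by (simp only: img)
    qed
    \<comment> \<open>At the last child the remaining list is a singleton, so distinctness is
      vacuous and only the initial bounds remain; with no children both sides are
      \<open>R\<close>.\<close>
    moreover have "K (m - 1) = conf Y"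
    proof (cases m)
      case 0
      then show ?thesis by (simp add: K_def start m_def)
    next
      case (Suc n)
      then have "drop n P = [P ! n]"
        by (simp add: m_def Cons_nth_drop_Suc[symmetric])
      then show ?thesis by (auto simp: K_def start Suc less_Suc_eq)
    qed
    moreover have "K 0 = {k \<in> R. inj_on k (set P) \<and> (\<forall>s\<in>set P. k s < N - 1)}"
      by (simp add: K_def)
    ultimately show ?thesis by simp
  qed
  have s3: "moves (concat (map (\<lambda>i. D_circ (Pair x) (Pair (P ! i)) (N - 1)) [0..<m]))
      (enc (V \<union> set P) ` {k \<in> R. inj_on k (set P) \<and> (\<forall>s\<in>set P. k s < N - 1)})
      (enc (V \<union> set P) ` conf (insert x Y))"
  proof -
    let ?K = "{k \<in> R. inj_on k (set P) \<and> (\<forall>s\<in>set P. k s < N - 1)}"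
    have "map (\<lambda>i. D_circ (Pair x) (Pair (P ! i)) (N - 1)) [0..<m]
      = map (\<lambda>s. D_circ (Pair x) (Pair s) (N - 1)) P"
      using map_nth[of P] unfolding m_def by (metis (no_types, lifting) map_map comp_def map_cong)
    moreover have "moves (concat (map (\<lambda>s. D_circ (Pair x) (Pair s) (N - 1)) P))
      (enc (V \<union> set P) ` ?K) (enc (V \<union> set P) ` distinguish x (N - 1) (set P) ` ?K)"
      using x x_in xP P_in P(2) N by (intro moves_Ds) (auto simp: V_def)
    moreover have "distinguish x (N - 1) (set P) ` ?K = conf (insert x Y)"
      unfolding finish
    proof (rule distinguish_image)
      show "k' \<in> R" if "k \<in> R" "\<And>s. s \<notin> set P \<Longrightarrow> k' s = k s" for k k'
        using that by (rule R_indep)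
    qed (use xP R_x in auto)
    ultimately show ?thesis by simp
  qed
  have "expand_circ x = concat (map (\<lambda>i. W_circ ang (Pair (P ! i)) (N - 1 - i)) [0..<m]) @
     concat (map (\<lambda>i. concat (map (\<lambda>j. D_circ (Pair (P ! i)) (Pair (P ! j)) (N - 2 - i)) [i + 1..<m])) (rev [0..<m - 1])) @
     concat (map (\<lambda>i. D_circ (Pair x) (Pair (P ! i)) (N - 1)) [0..<m])"
    by (simp only: expand_circ_def Let_def concat_concat_map flip: P_def m_def)
  then show ?thesis
    using carries_append[OF s1 carries_append[OF s2 s3]] by (simp add: V' V_def)
qed

text \<open>Well-founded induction along the edges, with the set \<open>Y\<close> of expanded nodes
  arbitrary, since a call for one child starts after the subtrees of its earlier siblings have been
  processed.\<close>

lemma moves_A: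
  assumes "x \<in> visited Y" "Y \<subseteq> visited Y" "subtree x \<inter> Y = {}"
  shows "moves (A_circ ang E N x) (enc (visited Y) ` conf Y)
    (enc (visited (Y \<union> subtree x)) ` conf (Y \<union> subtree x))"
  using finite_acyclic_wf[OF finite_E acyclic_E] assms
proof (induction x arbitrary: Y rule: wf_induct_rule)
  case (less x)
  have mono: "visited Y \<subseteq> visited Y'" if "Y \<subseteq> Y'" for Y Y'
    using that by (auto simp: visited_def)
  \<comment> \<open>Inner induction along the list of children: each call adds a subtree to
    \<open>Y\<close>, and disjointness of sibling subtrees keeps the remaining ones
    unexpanded.\<close>
  have children: "moves (concat (map (A_circ ang E N) js)) (enc (visited Y) ` conf Y)
      (enc (visited (Y \<union> \<Union>(subtree ` set js))) ` conf (Y \<union> \<Union>(subtree ` set js)))"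
    if "set js \<subseteq> pred E x" "distinct js" "set js \<subseteq> visited Y" "Y \<subseteq> visited Y"
      "\<And>p. p \<in> set js \<Longrightarrow> subtree p \<inter> Y = {}" for js Y
    using that
  proof (induction js arbitrary: Y)
    case (Cons p js)
    let ?Y = "Y \<union> subtree p"
    have p: "(p, x) \<in> E" using Cons.prems by (simp add: pred_def)
    \<comment> \<open>\<open>p\<close> was visited beforehand, and any other node of the subtree has
      its parent inside the subtree.\<close>
    have "subtree p \<subseteq> visited ?Y"
    proof
      fix y assume "y \<in> subtree p"
      then consider "y = p" | w where "(y, w) \<in> E" "w \<in> subtree p"
        unfolding subtree_def by (auto elim: converse_rtranclE)
      then show "y \<in> visited ?Y"
        using Cons.prems(3) mono[of Y ?Y] by cases (auto simp: visited_def pred_def)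
    qed
    then have Y': "?Y \<subseteq> visited ?Y"
      using Cons.prems(4) mono[of Y ?Y] by blast
    have "moves (A_circ ang E N p) (enc (visited Y) ` conf Y) (enc (visited ?Y) ` conf ?Y)"
      using Cons.prems by (intro less.IH[OF p]) auto
    moreover have "moves (concat (map (A_circ ang E N) js)) (enc (visited ?Y) ` conf ?Y)
      (enc (visited (?Y \<union> \<Union>(subtree ` set js))) ` conf (?Y \<union> \<Union>(subtree ` set js)))"
    proof (rule Cons.IH)
      show "subtree q \<inter> ?Y = {}" if "q \<in> set js" for q
      proof -
        have "q \<noteq> p" using that Cons.prems(2) by auto
        then have "subtree q \<inter> subtree p = {}"
          using that Cons.prems(1) by (intro subtree_disjoint[of _ x]) auto
        moreover have "subtree q \<inter> Y = {}" using that Cons.prems(5) by simp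
        ultimately show ?thesis by blast
      qed
    qed (use Cons.prems Y' mono[of Y ?Y] in auto)
    ultimately show ?case
      using carries_append by (fastforce simp: Un_assoc)
  qed simp
  have x_sub: "x \<in> subtree x" by (simp add: subtree_def)
  have "moves (expand_circ x) (enc (visited Y) ` conf Y)
      (enc (visited (insert x Y)) ` conf (insert x Y))"
    using less.prems x_sub by (intro moves_expand) auto
  moreover have "moves (concat (map (A_circ ang E N) (sorted_list_of_set (pred E x))))
      (enc (visited (insert x Y)) ` conf (insert x Y))
      (enc (visited (insert x Y \<union> \<Union>(subtree ` pred E x))) ` conf (insert x Y \<union> \<Union>(subtree ` pred E x)))"
  proof -
    let ?js = "sorted_list_of_set (pred E x)"
    have js: "set ?js = pred E x" "distinct ?js" using finite_pred by simp_all
    have "pred E x \<subseteq> visited (insert x Y)" "insert x Y \<subseteq> visited (insert x Y)"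
      using less.prems(1,2) mono[of Y "insert x Y"] by (auto simp: visited_def)
    moreover have "subtree p \<inter> insert x Y = {}" if "p \<in> pred E x" for p
    proof -
      have "subtree p \<subseteq> subtree x" using that subtree_unfold[of x] by blast
      then show ?thesis using less.prems(3) not_in_child_subtree[OF that] by blast
    qed
    ultimately show ?thesis
      using children[of ?js "insert x Y"] js by simp
  qed
  ultimately have "moves (A_circ ang E N x) (enc (visited Y) ` conf Y)
      (enc (visited (insert x Y \<union> \<Union>(subtree ` pred E x))) ` conf (insert x Y \<union> \<Union>(subtree ` pred E x)))"
    unfolding A_circ_expand[of x] by (rule carries_append)
  moreover have "insert x Y \<union> \<Union>(subtree ` pred E x) = Y \<union> subtree x"
    by (subst subtree_unfold[of x]) auto
  ultimately show ?case by simp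
qed

lemma all_visited: "visited {1..M} = {1..M}"
proof
  show "visited {1..M} \<subseteq> {1..M}"
    using rt_in E_in unfolding visited_def pred_def by blast
  show "{1..M} \<subseteq> visited {1..M}"
  proof
    fix r assume r: "r \<in> {1..M}"
    show "r \<in> visited {1..M}"
    proof (cases "r = rt")
      case False
      then obtain y where "(r, y) \<in> E" using r parent_exists by blast
      then show ?thesis using E_in unfolding visited_def pred_def by blast
    qed (simp add: visited_def)
  qed
qed

text \<open>No register is initialised at the start. The partial W-state on the root, whose bound is
  \<open>N\<close>, reaches \<open>conf {}\<close>; expanding the subtree of the root then covers
  all nodes.\<close>

lemma moves_prep:
  "moves (prep_circ ang E rt N) (enc {} ` {k. \<forall>r\<in>{1..M}. k r < bound r})
     (enc {1..M} ` conf {1..M})"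
proof -
  let ?K = "{k. \<forall>r\<in>{1..M}. k r < bound r}"
  have bound_rt: "bound rt = N" by (simp add: bound_def)
  have "moves (W_circ ang (Pair rt) N) (enc {} ` ?K) (enc {rt} ` ?K)"
  proof (rule moves_W)
    show "k rt < N" if "k \<in> ?K" for k
    proof -
      have "k rt < bound rt" using that rt_in by blast
      then show ?thesis by (simp add: bound_rt)
    qed
  qed (use rt_in bound_rt in auto)
  moreover have "?K = conf {}" "visited {} = {rt}"
  proof -
    show v: "visited {} = {rt}" by (simp add: visited_def)
    have "?K = {k. k rt < bound rt \<and> (\<forall>r\<in>{1..M} - {rt}. k r < bound r)}"
      using rt_in by blast
    then show "?K = conf {}" by (simp add: conf_def bound_rt v)
  qed
  moreover have "visited {1..M} = {1..M}"
    by (rule all_visited)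
  moreover have "moves (A_circ ang E N rt) (enc (visited {}) ` conf {})
      (enc (visited {1..M}) ` conf {1..M})"
    using moves_A[of rt "{}"] by (simp add: visited_def subtree_rt)
  ultimately show ?thesis
    unfolding prep_circ_def by (auto intro: carries_append)
qed

section \<open>Feasible states\<close>

text \<open>A sum of nonnegative integers vanishes iff every term does. The order
  \<open>r < s\<close> in \<open>psi_T\<close> weakens to \<open>r \<noteq> s\<close> because the
  condition is symmetric.\<close>

lemma feasible_iff:
  "feasible M N E x \<longleftrightarrow>
     (\<forall>r\<in>{1..M}. \<exists>i<N. \<forall>j<N. x (r, j) \<longleftrightarrow> j = i) \<and>
     (\<forall>r s i. (r, s) \<in> E \<longrightarrow> i < N \<longrightarrow> \<not> (x (r, i) \<and> x (s, i))) \<and>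
     (\<forall>y r s i. (r, y) \<in> E \<longrightarrow> (s, y) \<in> E \<longrightarrow> r \<noteq> s \<longrightarrow> i < N \<longrightarrow> \<not> (x (r, i) \<and> x (s, i)))"
proof -
  have "(\<Sum>i<N. of_bool (x (r, i))) - 1 = (0 :: int) \<longleftrightarrow> (\<exists>i<N. \<forall>j<N. x (r, j) \<longleftrightarrow> j = i)" for r
  proof -
    have "(\<Sum>i<N. of_bool (x (r, i))) = int (card {i. i < N \<and> x (r, i)})"
      by (simp add: sum.If_cases of_bool_def lessThan_def Collect_conj_eq)
    then have "(\<Sum>i<N. of_bool (x (r, i))) - 1 = (0 :: int) \<longleftrightarrow> card {i. i < N \<and> x (r, i)} = 1"
      by auto
    also have "\<dots> \<longleftrightarrow> (\<exists>i<N. \<forall>j<N. x (r, j) \<longleftrightarrow> j = i)"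
      unfolding card_1_singleton_iff One_nat_def by (auto simp: set_eq_iff)
    finally show ?thesis .
  qed
  then have 1: "(\<Sum>r\<in>{1..M}. ((\<Sum>i<N. of_bool (x (r, i))) - 1)\<^sup>2) = (0 :: int) \<longleftrightarrow>
      (\<forall>r\<in>{1..M}. \<exists>i<N. \<forall>j<N. x (r, j) \<longleftrightarrow> j = i)"
    by (subst sum_nonneg_eq_0_iff) auto
  have 2: "(\<Sum>(r, s)\<in>B. \<Sum>i<N. of_bool (x (r, i)) * of_bool (x (s, i))) = (0 :: int) \<longleftrightarrow>
      (\<forall>r s i. (r, s) \<in> B \<longrightarrow> i < N \<longrightarrow> \<not> (x (r, i) \<and> x (s, i)))" if "finite B" for B
  proof -
    have "(\<Sum>i<N. of_bool (x (r, i)) * of_bool (x (s, i))) = (0 :: int) \<longleftrightarrow>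
       (\<forall>i<N. \<not> (x (r, i) \<and> x (s, i)))" for r s
      by (subst sum_nonneg_eq_0_iff) auto
    then show ?thesis
      using that by (subst sum_nonneg_eq_0_iff) (auto intro!: sum_nonneg)
  qed
  have "psi_T M E \<subseteq> {1..M} \<times> {1..M}"
    using E_in by (auto simp: psi_T_def pred_def)
  then have fin: "finite (psi_T M E)"
    by (rule finite_subset) simp
  have psi: "(r, s) \<in> psi_T M E \<longleftrightarrow> r < s \<and> (\<exists>y. (r, y) \<in> E \<and> (s, y) \<in> E)" for r s
    using E_in by (auto simp: psi_T_def pred_def)
  have "(\<forall>r s i. (r, s) \<in> psi_T M E \<longrightarrow> i < N \<longrightarrow> \<not> (x (r, i) \<and> x (s, i))) \<longleftrightarrow>
      (\<forall>y r s i. (r, y) \<in> E \<longrightarrow> (s, y) \<in> E \<longrightarrow> r \<noteq> s \<longrightarrow> i < N \<longrightarrow> \<not> (x (r, i) \<and> x (s, i)))"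
    (is "?l \<longleftrightarrow> ?r")
  proof
    assume l: ?l
    show ?r
    proof (intro allI impI)
      fix y r s i assume "(r, y) \<in> E" "(s, y) \<in> E" "r \<noteq> s" "i < N"
      then show "\<not> (x (r, i) \<and> x (s, i))"
        using l[rule_format, of r s i] l[rule_format, of s r i] psi by (metis linorder_neqE_nat)
    qed
  next
    assume r: ?r
    show ?l
    proof (intro allI impI)
      fix r s i assume "(r, s) \<in> psi_T M E" "i < N"
      moreover from this obtain y where "r < s" "(r, y) \<in> E" "(s, y) \<in> E"
        using psi by blast
      ultimately show "\<not> (x (r, i) \<and> x (s, i))"
        using r[rule_format, of r y s i] by simp
    qed
  qed
  then show ?thesis
    by (simp only: feasible_def 1 2[OF finite_E] 2[OF fin])
qed

text \<open>With all registers initialised, \<open>enc\<close> has its 1 in register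
  \<open>r\<close> at \<open>k r\<close>. Thus (C1) amounts to the existence of \<open>k\<close>,
  and (C2) and (C3) amount to \<open>proper\<close> at every node.\<close>

lemma enc_conf_eq_feasible:
  "enc {1..M} ` conf {1..M} = {x \<in> basis Q. feasible M N E x}" (is "?L = ?R")
proof
  show "?L \<subseteq> ?R"
  proof
    fix x assume "x \<in> ?L"
    then obtain k where k: "k \<in> conf {1..M}" and x: "x = enc {1..M} k" by auto
    have proper: "proper y k" if "(r, y) \<in> E" for r y
      using k E_in[OF that] unfolding conf_def by blast
    have lt: "k r < N" if "r \<in> {1..M}" for r
    proof (cases "r = rt")
      case False
      then obtain y where "(r, y) \<in> E"
        using parent_exists \<open>r \<in> {1..M}\<close> by blast
      then have "k r \<le> N - 1" using proper[of r y] by (simp add: proper_def pred_def)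
      then show ?thesis using N by linarith
    qed (use k in \<open>simp add: conf_def\<close>)
    have val: "x (r, i) \<longleftrightarrow> i = k r" if "r \<in> {1..M}" "i < N" for r i
      using that by (simp add: x enc_apply)
    have "feasible M N E x"
      unfolding feasible_iff
    proof (intro conjI ballI allI impI)
      show "\<exists>i<N. \<forall>j<N. x (r, j) \<longleftrightarrow> j = i" if "r \<in> {1..M}" for r
        using lt[OF that] val[OF that] by blast
      show "\<not> (x (r, i) \<and> x (s, i))" if "(r, s) \<in> E" "i < N" for r s i
      proof -
        have "k r \<noteq> k s" using proper[OF that(1)] that(1) by (simp add: proper_def pred_def)
        then show ?thesis using val E_in[OF that(1)] that(2) by metis
      qed
      show "\<not> (x (r, i) \<and> x (s, i))"
        if "(r, y) \<in> E" "(s, y) \<in> E" "r \<noteq> s" "i < N" for y r s i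
      proof -
        have "k r \<noteq> k s"
          using proper[OF that(1)] that(1-3) by (auto simp: proper_def pred_def inj_on_def)
        then show ?thesis using val E_in[OF that(1)] E_in[OF that(2)] that(4) by metis
      qed
    qed
    then show "x \<in> ?R" by (simp add: x enc_in_basis)
  qed
  show "?R \<subseteq> ?L"
  proof
    fix x assume "x \<in> ?R"
    then have x: "x \<in> basis Q" "feasible M N E x" by auto
    then obtain k where k: "\<And>r. r \<in> {1..M} \<Longrightarrow> k r < N \<and> (\<forall>j<N. x (r, j) \<longleftrightarrow> j = k r)"
      unfolding feasible_iff by metis
    have "x = enc {1..M} k"
      using x(1) k by (auto simp: enc_def basis_def qubits_def PiE_def extensional_def fun_eq_iff)
    moreover have "proper y k" if "y \<in> {1..M}" for y
    proof -
      have "k r \<noteq> k y" if "(r, y) \<in> E" for r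
        using x(2) k E_in[OF that] that unfolding feasible_iff by metis
      moreover have "k r \<noteq> k s" if "(r, y) \<in> E" "(s, y) \<in> E" "r \<noteq> s" for r s
        using x(2) k E_in[OF that(1)] E_in[OF that(2)] that unfolding feasible_iff by metis
      moreover have "k r \<le> N - 1" if "(r, y) \<in> E" for r
        using k E_in[OF that] by fastforce
      ultimately show ?thesis
        by (auto simp: proper_def pred_def inj_on_def)
    qed
    \<comment> \<open>No register is left unvisited, so the bounds in \<open>conf\<close> become
      vacuous.\<close>
    moreover have "{1..M} \<subseteq> visited {1..M}"
      using all_visited by simp
    ultimately show "x \<in> ?L"
      using k rt_in by (auto simp: conf_def)
  qed
qed

lemma mixer_preserves_feasible_space:
  assumes "\<psi> \<in> feasible_space M N E"
  shows "U_prep G ang E rt N (U_tag M N \<phi> (adj Q (U_prep G ang E rt N) \<psi>)) \<in> feasible_space M N E"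
proof -
  let ?c = "prep_circ ang E rt N" and ?Z = "enc {} ` {k. \<forall>r\<in>{1..M}. k r < bound r}"
  have fin: "finite Q" by (simp add: qubits_def)
  have space: "feasible_space M N E = supp {x \<in> basis Q. feasible M N E x}"
    unfolding feasible_space_def using finite_basis[OF fin] by (intro span_ket_eq_supp) simp
  have img: "run G ?c ` supp ?Z = feasible_space M N E" and wf: "\<forall>g\<in>set ?c. gate_on Q g"
    using moves_prep unfolding carries_def space enc_conf_eq_feasible by auto
  \<comment> \<open>Surjectivity of the preparation onto the feasible space supplies a preimage,
    which the adjoint then recovers.\<close>
  obtain \<eta> where \<eta>: "\<eta> \<in> supp ?Z" "\<psi> = run G ?c \<eta>"
    using assms img by blast
  have "\<eta> \<in> supp (basis Q)"
    using \<eta>(1) supp_mono[of ?Z "basis Q"] enc_in_basis by blast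
  then have "adj Q (run G ?c) \<psi> = \<eta>"
    using adj_run_run[OF unitary fin wf] \<eta>(2) by simp
  then show ?thesis
    using U_tag_supp[OF \<eta>(1)] img unfolding U_prep_def by auto
qed

end

theorem mainTheorem2:
  fixes M N rt :: nat and E :: "(nat \<times> nat) set"
    and G :: "real \<Rightarrow> complex^2^2" and ang :: "nat \<Rightarrow> nat \<Rightarrow> real"
    and \<phi> :: real and \<psi> :: "(nat \<times> nat) state"
  assumes "M \<ge> 1" and "N \<ge> 1"
    and "rooted_tree M E rt"
    and "\<And>\<theta>. unitary (G \<theta>)"
    and "W_angles G ang N"
    and "\<psi> \<in> feasible_space M N E"
  shows "U_prep G ang E rt N (U_tag M N \<phi> (adj (qubits M N) (U_prep G ang E rt N) \<psi>))
           \<in> feasible_space M N E"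
proof -
  interpret tree_circuit M N rt E G ang
    by unfold_locales (fact assms)+
  show ?thesis
    using assms(6) by (rule mixer_preserves_feasible_space)
qed

end
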